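(* Let $f\colon \mathbb{N}\to \{s\in\mathbb{C}: |s|\le 1\}$ be a multiplicative function and let $x,y,z,M$ be positive real numbers with $M\ge 1$, $4<y\le z^{1/2}$ and $z<x$. Let $E\colon \mathbb{R}^+\to\mathbb{R}^+$ be a decreasing function with $\lim_{X\to\infty}E(X)=0$. Assume that there exist a complex number $\varrho$ with $|\varrho|\le 1$ and a constant $C>0$ such that for all real $Y\ge y$, $$\Big|\sum_{y<p\le Y} f(p) - \varrho\,(\pi(Y)-\pi(y))\Big| \le C\, M\, Y\, E(y).$$ Then $$\sum_{n\le x} f(n) \ll \frac{|\varrho|\, x}{\log z}\left(\frac{\log x}{\log y}\right)^{|\varrho|}\exp\Big(\sum_{p\le y}\frac{|f(p)|}{p}\Big) + \Psi(x,z) + M x(\log x)^2\Big(E(y)+\frac1y\Big),$$ where the implied constant depends at most on $C$.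
   Context: $p$ denotes primes, and $\pi(Y)$ is the number of primes up to $Y$. A positive integer is $z$-smooth if it has no prime factor exceeding $z$; $\Psi(x,z)$ denotes the number of $z$-smooth positive integers up to $x$. Multiplicative functions satisfy $f(1)=1$. *)

theory Defs
  imports "HOL-Analysis.Analysis" "HOL-Computational_Algebra.Primes"
begin

text \<open>
  Arithmetic functions are functions on the positive integers; they are represented by functions
  on \<^typ>\<open>nat\<close> whose value at 0 is never constrained or used.
\<close>
definition multiplicative_fun :: "(nat \<Rightarrow> complex) \<Rightarrow> bool" where
  "multiplicative_fun f \<longleftrightarrow>
     f 1 = 1 \<and> (\<forall>m n. m > 0 \<longrightarrow> n > 0 \<longrightarrow> coprime m n \<longrightarrow> f (m * n) = f m * f n)"

definition primes_pi :: "real \<Rightarrow> nat" where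
  "primes_pi Y = card {p::nat. prime p \<and> real p \<le> Y}"

definition smooth_nat :: "real \<Rightarrow> nat \<Rightarrow> bool" where
  "smooth_nat z n \<longleftrightarrow> n > 0 \<and> (\<forall>p. prime p \<longrightarrow> p dvd n \<longrightarrow> real p \<le> z)"

definition smooth_count :: "real \<Rightarrow> real \<Rightarrow> nat" where
  "smooth_count x z = card {n. real n \<le> x \<and> smooth_nat z n}"

end

theory Submission
  imports Defs
begin

text \<open>
  Let \<open>g\<close> be the multiplicative function that agrees with \<open>f\<close> at powers of primes \<open>p \<le> y\<close> and has
  \<open>g (p ^ k) = \<rho> ^ k\<close> for \<open>p > y\<close>. Passing from \<open>g\<close> to \<open>f\<close> one prime \<open>t > y\<close> at a time changes the mean
  value by \<open>\<Sum>\<^sub>t (f t - \<rho>) \<Sum>\<^sub>w g\<^sub>t w\<close>, the inner sum over \<open>w \<le> x / t\<close> not divisible by \<open>t\<close>, up to the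
  multiples of \<open>t\<^sup>2\<close>, which number \<open>O(x / y)\<close> altogether. For fixed \<open>w\<close> the weight \<open>g\<^sub>t w\<close> changes with
  \<open>t\<close> only near the divisors of \<open>w\<close>; partial summation in \<open>t\<close> together with the hypothesis gives
  \<open>O(M E(y) x d(w) / w)\<close>, and \<open>\<Sum>\<^sub>w d(w) / w = O((ln x)\<^sup>2)\<close>.

  For \<open>g\<close> itself, the \<open>z\<close>-smooth integers contribute at most \<open>\<Psi>(x, z)\<close>. Any other \<open>n\<close> is \<open>p m\<close> with
  \<open>p > z\<close>, where \<open>g (p m) = \<rho> g m\<close>; as there are \<open>O(x / (m ln z))\<close> choices of \<open>p\<close> by Chebyshev, these
  contribute \<open>O(\<bar>\<rho>\<bar> x / ln z) \<Sum>\<^sub>m \<bar>g m\<bar> / m\<close>, which an Euler product and Mertens' estimate for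
  \<open>\<Sum> 1 / p\<close> bound.
\<close>

subsection \<open>Chebyshev and Mertens bounds\<close>

lemma prod_primes_dvd:
  fixes n :: nat
  assumes "finite P" "\<And>p. p \<in> P \<Longrightarrow> prime p" "\<And>p. p \<in> P \<Longrightarrow> p dvd n"
  shows "\<Prod>P dvd n"
  using assms
proof (induction P rule: finite_induct)
  case (insert p P)
  have "coprime p (\<Prod>P)"
    using insert by (intro prod_coprime_right) (metis insertCI primes_coprime)
  with insert show ?case by (simp add: divides_mult)
qed simp

text \<open>Erdos's induction. For odd \<open>n = 2 * m + 1\<close>, the primes in
  \<open>(m + 1, n]\<close> all divide \<open>n choose m\<close>, and this is at most
  \<open>4 ^ m\<close> because, by symmetry, the binomials with index up to \<open>m\<close> make up
  half of the row sum \<open>2 ^ n\<close>. An even \<open>n > 2\<close> is not prime, so nothing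
  changes from \<open>n - 1\<close>.\<close>

lemma primorial_le: "\<Prod>{p::nat. prime p \<and> p \<le> n} \<le> 4 ^ n"
proof (induction n rule: less_induct)
  case (less n)
  show ?case
  proof (cases "n \<le> 2")
    case True
    then consider "n = 0" | "n = 1" | "n = 2" by linarith
    then show ?thesis
    proof cases
      case 3
      then have "{p::nat. prime p \<and> p \<le> n} = {2}"
        by (auto dest: prime_ge_2_nat intro!: antisym)
      with 3 show ?thesis by simp
    next
      case 1
      then have "{p::nat. prime p \<and> p \<le> n} = {}" by (auto dest: prime_gt_0_nat)
      then show ?thesis by (simp only: prod.empty) simp
    next
      case 2
      then have "{p::nat. prime p \<and> p \<le> n} = {}" by (auto dest: prime_ge_2_nat)
      then show ?thesis by (simp only: prod.empty) simp
    qed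
  next
    case False
    show ?thesis
    proof (cases "even n")
      case True
      with False have "\<not> prime n" using prime_odd_nat by auto
      then have "{p::nat. prime p \<and> p \<le> n} = {p. prime p \<and> p \<le> n - 1}"
        by (auto simp: le_less)
      also have "\<Prod>\<dots> \<le> 4 ^ (n - 1)" using less[of "n - 1"] False by simp
      also have "\<dots> \<le> 4 ^ n" by (intro power_increasing) auto
      finally show ?thesis .
    next
      case odd: False
      then obtain m where m: "n = 2 * m + 1" by (elim oddE)
      with False have "m \<ge> 1" by simp
      define Q where "Q = {p::nat. prime p \<and> m + 1 < p \<and> p \<le> n}"
      have split: "{p::nat. prime p \<and> p \<le> n} = {p. prime p \<and> p \<le> m + 1} \<union> Q"
        unfolding Q_def m by auto
      have choose_dvd: "p dvd n choose m" if "p \<in> Q" for p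
      proof -
        have p: "prime p" "m + 1 < p" "p \<le> n" using that by (auto simp: Q_def)
        have "fact m * fact (n - m) * (n choose m) = (fact n :: nat)"
          using m by (intro binomial_fact_lemma) auto
        moreover have "p dvd fact n" using p by (simp add: prime_dvd_fact_iff)
        ultimately have "p dvd fact m * fact (n - m) * (n choose m)" by simp
        moreover have "\<not> p dvd fact m" "\<not> p dvd fact (n - m)"
          unfolding prime_dvd_fact_iff [OF p(1)] using p m by simp_all
        ultimately show ?thesis using p(1) by (simp add: prime_dvd_mult_iff)
      qed
      have "\<Prod>Q dvd n choose m"
        using choose_dvd by (intro prod_primes_dvd) (auto simp: Q_def)
      then have "\<Prod>Q \<le> n choose m"
        by (rule dvd_imp_le) (use m in auto)
      also have "\<dots> \<le> (\<Sum>k\<le>m. (2 * m + 1 choose k))"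
        unfolding m by (rule member_le_sum) auto
      also have "\<dots> = 4 ^ m" by (simp only: binomial_r_part_sum) (simp add: power_mult)
      finally have "\<Prod>Q \<le> 4 ^ m" .
      moreover have "\<Prod>{p::nat. prime p \<and> p \<le> m + 1} \<le> 4 ^ (m + 1)"
        using less[of "m + 1"] m \<open>m \<ge> 1\<close> by simp
      moreover have "\<Prod>{p::nat. prime p \<and> p \<le> n} = \<Prod>{p. prime p \<and> p \<le> m + 1} * \<Prod>Q"
        unfolding split by (rule prod.union_disjoint) (auto simp: Q_def)
      ultimately have "\<Prod>{p::nat. prime p \<and> p \<le> n} \<le> 4 ^ (m + 1) * 4 ^ m"
        by (simp only: mult_le_mono)
      also have "\<dots> = 4 ^ n" by (simp add: m power_add mult_2)
      finally show ?thesis .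
    qed
  qed
qed

text \<open>Chebyshev's bound for the theta function. It is the only input on the density of primes,
  serving both Mertens' estimate and the count of primes above \<open>z\<close>.\<close>

lemma sum_ln_primes_le: "(\<Sum>p | prime p \<and> p \<le> n. ln (real p)) \<le> real n * ln 4"
proof -
  have "(\<Sum>p | prime p \<and> p \<le> n. ln (real p)) = ln (real (\<Prod>{p::nat. prime p \<and> p \<le> n}))"
    unfolding of_nat_prod by (rule ln_prod [symmetric]) (auto simp: prime_gt_0_nat)
  also have "\<dots> \<le> ln (real (4 ^ n))"
  proof (subst ln_le_cancel_iff)
    show "0 < real (\<Prod>{p::nat. prime p \<and> p \<le> n})"
      unfolding of_nat_prod by (rule prod_pos) (auto simp: prime_gt_0_nat)
    show "real (\<Prod>{p::nat. prime p \<and> p \<le> n}) \<le> real (4 ^ n)"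
      using primorial_le[of n] of_nat_le_iff by blast
  qed simp
  also have "\<dots> = real n * ln 4" by (simp add: ln_realpow)
  finally show ?thesis .
qed

section \<open>Mertens' estimates\<close>

lemma sum_multiples:
  fixes d N :: nat
  assumes "d > 0"
  shows "(\<Sum>n | n \<in> {1..N} \<and> d dvd n. h n) = (\<Sum>m\<in>{1..N div d}. h (d * m))"
proof -
  have "{n. n \<in> {1..N} \<and> d dvd n} = (\<lambda>m. d * m) ` {1..N div d}"
    using assms by (auto simp: less_eq_div_iff_mult_less_eq mult.commute elim!: dvdE)
  moreover have "inj_on (\<lambda>m. d * m) {1..N div d}" using assms by (auto simp: inj_on_def)
  ultimately show ?thesis by (simp add: sum.reindex)
qed

lemma sum_ln_prime_factors_le:
  fixes n :: nat
  assumes "n > 0"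
  shows "(\<Sum>p\<in>prime_factors n. ln (real p)) \<le> ln (real n)"
proof -
  have "\<Prod>(prime_factors n) dvd n" by (rule prod_primes_dvd) auto
  then have "\<Prod>(prime_factors n) \<le> n" using assms by (rule dvd_imp_le)
  moreover have "0 < \<Prod>(prime_factors n)"
    by (intro prod_pos) (auto simp: in_prime_factors_iff prime_gt_0_nat)
  ultimately have "ln (real (\<Prod>(prime_factors n))) \<le> ln (real n)"
    by (subst ln_le_cancel_iff) (use assms in \<open>simp_all only: of_nat_0_less_iff of_nat_le_iff\<close>)
  also have "ln (real (\<Prod>(prime_factors n))) = (\<Sum>p\<in>prime_factors n. ln (real p))"
    unfolding of_nat_prod by (rule ln_prod) (auto simp: in_prime_factors_iff prime_gt_0_nat)
  finally show ?thesis .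
qed

text \<open>Compare \<open>\<Sum>\<^sub>p (N div p) ln p \<le> ln (N!) \<le> N ln N\<close> with \<open>N div p \<ge> N / p - 1\<close>.\<close>

lemma sum_ln_over_primes_le:
  fixes N :: nat
  assumes "N > 0"
  shows "(\<Sum>p | prime p \<and> p \<le> N. ln (real p) / real p) \<le> ln (real N) + ln 4"
proof -
  let ?P = "{p. prime p \<and> p \<le> N}"
  have "(\<Sum>p\<in>?P. real (N div p) * ln (real p))
      = (\<Sum>p\<in>?P. \<Sum>n\<in>{1..N}. if p dvd n then ln (real p) else 0)"
  proof (rule sum.cong)
    fix p assume "p \<in> ?P"
    then have "p > 0" by (simp add: prime_gt_0_nat)
    then show "real (N div p) * ln (real p) = (\<Sum>n\<in>{1..N}. if p dvd n then ln (real p) else 0)"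
      using sum_multiples[of p "\<lambda>_. 1 :: nat" N] by (simp flip: sum.inter_filter)
  qed simp
  also have "\<dots> = (\<Sum>n\<in>{1..N}. \<Sum>p\<in>?P. if p dvd n then ln (real p) else 0)"
    by (rule sum.swap)
  also have "\<dots> = (\<Sum>n\<in>{1..N}. \<Sum>p\<in>prime_factors n. ln (real p))"
  proof (rule sum.cong)
    fix n assume n: "n \<in> {1..N}"
    then have "{p \<in> ?P. p dvd n} = prime_factors n"
      by (auto simp: in_prime_factors_iff intro: order_trans [OF dvd_imp_le])
    then show "(\<Sum>p\<in>?P. if p dvd n then ln (real p) else 0) = (\<Sum>p\<in>prime_factors n. ln (real p))"
      by (simp flip: sum.inter_filter)
  qed simp
  also have "\<dots> \<le> (\<Sum>n\<in>{1..N}. ln (real N))"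
  proof (rule sum_mono)
    fix n assume n: "n \<in> {1..N}"
    then have "(\<Sum>p\<in>prime_factors n. ln (real p)) \<le> ln (real n)"
      by (intro sum_ln_prime_factors_le) simp
    also have "\<dots> \<le> ln (real N)" using n by simp
    finally show "(\<Sum>p\<in>prime_factors n. ln (real p)) \<le> ln (real N)" .
  qed
  also have "\<dots> = real N * ln (real N)" by simp
  finally have 1: "(\<Sum>p\<in>?P. real (N div p) * ln (real p)) \<le> real N * ln (real N)" .
  have "real N * (\<Sum>p\<in>?P. ln (real p) / real p) = (\<Sum>p\<in>?P. (real N / real p) * ln (real p))"
    by (simp add: sum_distrib_left)
  also have "\<dots> \<le> (\<Sum>p\<in>?P. real (N div p) * ln (real p) + ln (real p))"
  proof (rule sum_mono)
    fix p assume "p \<in> ?P"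
    then have "p > 0" by (simp add: prime_gt_0_nat)
    have "real N / real p \<le> real (N div p) + 1"
      using real_of_int_floor_add_one_ge[of "real N / real p"] by (simp add: floor_divide_of_nat_eq)
    then have "(real N / real p) * ln (real p) \<le> (real (N div p) + 1) * ln (real p)"
      using \<open>p > 0\<close> by (intro mult_right_mono) auto
    then show "(real N / real p) * ln (real p) \<le> real (N div p) * ln (real p) + ln (real p)"
      by (simp add: algebra_simps)
  qed
  \<comment> \<open>Rounding costs at most \<open>ln p\<close> for each prime; Chebyshev's bound
    turns the total loss into \<open>N ln 4\<close>.\<close>
  also have "\<dots> \<le> real N * ln (real N) + real N * ln 4"
    unfolding sum.distrib by (intro add_mono 1 sum_ln_primes_le)
  finally have "real N * (\<Sum>p\<in>?P. ln (real p) / real p) \<le> real N * (ln (real N) + ln 4)"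
    by (simp add: algebra_simps)
  then show ?thesis using assms by (simp add: mult_le_cancel_left)
qed

lemma prime_le_Suc:
  "{p::nat. prime p \<and> p \<le> Suc N} =
     (if prime (Suc N) then insert (Suc N) {p. prime p \<and> p \<le> N} else {p. prime p \<and> p \<le> N})"
  by (auto simp: le_Suc_eq)

text \<open>Partial summation against \<open>1 / ln n\<close>, carried out as an induction on \<open>N\<close>.\<close>

lemma sum_inverse_primes_partial:
  fixes N :: nat
  assumes "N \<ge> 2"
  shows "(\<Sum>p | prime p \<and> p \<le> N. 1 / real p)
           - (\<Sum>p | prime p \<and> p \<le> N. ln (real p) / real p) / ln (real N)
         \<le> ln (ln (real N)) - ln (ln 2) + ln 4 * (1 / ln 2 - 1 / ln (real N))"
  using assms
proof (induction N rule: dec_induct)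
  case base
  have "{p::nat. prime p \<and> p \<le> 2} = {2}" by (auto dest: prime_ge_2_nat intro!: antisym)
  then show ?case by simp
next
  case (step N)
  let ?P = "{p. prime p \<and> p \<le> N}"
  let ?A = "\<Sum>p\<in>?P. ln (real p) / real p"
  let ?l = "ln (real N)" and ?l' = "ln (real (Suc N))"
  have l: "?l > 0" "?l' > 0" "?l < ?l'" using step by auto
  have A: "?A \<le> ?l + ln 4" using step by (intro sum_ln_over_primes_le) simp
  \<comment> \<open>If \<open>p = Suc N\<close> is prime, its two new terms cancel:
    \<open>1 / p = (ln p / p) / ln p\<close>. Only the weight of the old sum \<open>?A\<close>
    changes.\<close>
  have "(\<Sum>p | prime p \<and> p \<le> Suc N. 1 / real p)
           - (\<Sum>p | prime p \<and> p \<le> Suc N. ln (real p) / real p) / ?l'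
      = (\<Sum>p\<in>?P. 1 / real p) - ?A / ?l'"
    unfolding prime_le_Suc using l by (auto simp: add_divide_distrib)
  also have "\<dots> = ((\<Sum>p\<in>?P. 1 / real p) - ?A / ?l) + ?A * (1 / ?l - 1 / ?l')"
    by (simp add: algebra_simps)
  also have "\<dots> \<le> (ln ?l - ln (ln 2) + ln 4 * (1 / ln 2 - 1 / ?l)) + (?l + ln 4) * (1 / ?l - 1 / ?l')"
    using l by (intro add_mono step.IH mult_right_mono A) (simp add: field_simps)
  also have "\<dots> = ln ?l - ln (ln 2) + ln 4 * (1 / ln 2 - 1 / ?l') + (1 - ?l / ?l')"
    using l by (simp add: algebra_simps)
  \<comment> \<open>With \<open>u = ?l / ?l'\<close> this is \<open>ln u \<le> u - 1\<close>; it
    plays the part of the integral of \<open>1 / (t ln t)\<close>, and the increments telescope to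
    \<open>ln (ln N)\<close>.\<close>
  also have "1 - ?l / ?l' \<le> ln (?l' / ?l)"
    using ln_le_minus_one[of "?l / ?l'"] l by (simp add: ln_div)
  also have "ln (?l' / ?l) = ln ?l' - ln ?l" using l by (simp add: ln_div)
  finally show ?case by simp
qed

text \<open>The terms \<open>ln 4 / ln N\<close> cancel, which leaves the constant
  \<open>1 - ln (ln 2) + ln 4 / ln 2\<close>. It is at most 4 by \<open>ln 4 = 2 * ln 2\<close> and
  \<open>ln 2 \<ge> 1 / 2 \<ge> exp (-1)\<close>.\<close>

lemma sum_inverse_primes_le:
  fixes N :: nat
  assumes "N \<ge> 2"
  shows "(\<Sum>p | prime p \<and> p \<le> N. 1 / real p) \<le> ln (ln (real N)) + 4"
proof -
  have l: "ln (real N) > 0" "ln (real N) \<ge> ln 2" using assms by auto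
  have "(\<Sum>p | prime p \<and> p \<le> N. ln (real p) / real p) / ln (real N)
          \<le> (ln (real N) + ln 4) / ln (real N)"
    using assms l by (intro divide_right_mono sum_ln_over_primes_le) auto
  also have "\<dots> = 1 + ln 4 / ln (real N)" using l by (simp add: add_divide_distrib)
  finally have A: "(\<Sum>p | prime p \<and> p \<le> N. ln (real p) / real p) / ln (real N)
                     \<le> 1 + ln 4 / ln (real N)" .
  have "ln (4::real) = 2 * ln 2" using ln_realpow[of "2::real" 2] by simp
  moreover have "ln (ln (2::real)) \<ge> -1"
  proof -
    have "exp (-1) \<le> (1/2::real)"
      using exp_ge_add_one_self[of 1] by (simp add: exp_minus field_simps)
    also have "\<dots> \<le> ln 2" using ln_le_minus_one[of "1/2::real"] by (simp add: ln_div)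
    finally show ?thesis by (simp add: ln_ge_iff)
  qed
  ultimately show ?thesis using sum_inverse_primes_partial[OF assms] A
    by (simp add: algebra_simps)
qed

subsection \<open>Multiplicative functions and Euler products\<close>

lemma sum_inverse_squares_le:
  fixes a N :: nat
  assumes "a > 0"
  shows "(\<Sum>k\<in>{a<..N}. 1 / (real k)\<^sup>2) \<le> 1 / real a"
proof (cases "a \<le> N")
  case True
  \<comment> \<open>Keeping the term \<open>- 1 / N\<close> makes the bound telescope.\<close>
  then have "(\<Sum>k\<in>{a<..N}. 1 / (real k)\<^sup>2) \<le> 1 / real a - 1 / real N"
  proof (induction N rule: dec_induct)
    case (step N)
    have "1 / (real (Suc N))\<^sup>2 \<le> 1 / (real N * real (Suc N))"
      using step assms by (intro divide_left_mono) (auto simp: power2_eq_square)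
    also have "\<dots> = 1 / real N - 1 / real (Suc N)"
      using step assms by (simp add: field_simps)
    finally have "1 / (real (Suc N))\<^sup>2 \<le> 1 / real N - 1 / real (Suc N)" .
    moreover have "{a<..Suc N} = insert (Suc N) {a<..N}" using step by auto
    ultimately show ?case using step.IH by simp
  qed simp
  also have "\<dots> \<le> 1 / real a" by simp
  finally show ?thesis .
qed simp

lemma sum_power_le:
  fixes u :: real
  assumes "0 \<le> u" "u \<le> 1 / 2"
  shows "(\<Sum>k\<in>{2..N}. u ^ k) \<le> 2 * u\<^sup>2"
proof (cases "N \<ge> 1")
  case True
  \<comment> \<open>The extra \<open>2 * u ^ Suc N\<close> bounds the missing tail of the geometric
    series, as \<open>u \<le> 1 / 2\<close>; with it the induction closes.\<close>
  then have "(\<Sum>k\<in>{2..N}. u ^ k) + 2 * u ^ Suc N \<le> 2 * u\<^sup>2"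
  proof (induction N rule: dec_induct)
    case base
    then show ?case by (simp add: power2_eq_square)
  next
    case (step N)
    have "2 * (u * u ^ Suc N) \<le> 1 * u ^ Suc N"
      using assms mult_right_mono [of "2 * u" 1 "u ^ Suc N"] by (simp add: mult.assoc)
    with step show ?case by simp
  qed
  moreover have "u ^ Suc N \<ge> 0" using assms by simp
  ultimately show ?thesis by linarith
qed simp

lemma prime_power_decompose:
  fixes p n :: nat
  assumes "prime p" "n > 0"
  obtains k m where "n = p ^ k * m" "\<not> p dvd m" "m > 0"
proof -
  have "\<not> is_unit p" using assms by auto
  then obtain m where m: "n = p ^ multiplicity p n * m" "\<not> p dvd m"
    using multiplicity_decompose'[of n p] assms by blast
  moreover have "m > 0" using m assms by (auto intro!: gr0I)
  ultimately show thesis using that by blast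
qed

text \<open>A truncated Euler product. Splitting off the exact power of one prime \<open>p\<close>
  embeds the integers composed of \<open>insert p P\<close> into pairs (exponent, integer composed
  of \<open>P\<close>). There is only an inequality because some pairs have product above
  \<open>N\<close>.\<close>

lemma sum_multiplicative_le_prod:
  fixes a :: "nat \<Rightarrow> real"
  assumes "finite P" "\<And>p. p \<in> P \<Longrightarrow> prime p"
    and "a 1 = 1" "\<And>n. a n \<ge> 0"
    and mult: "\<And>m n. m > 0 \<Longrightarrow> n > 0 \<Longrightarrow> coprime m n \<Longrightarrow> a (m * n) = a m * a n"
  shows "(\<Sum>m | m \<in> {1..N} \<and> prime_factors m \<subseteq> P. a m) \<le> (\<Prod>p\<in>P. \<Sum>k\<le>N. a (p ^ k))"
  using assms(1,2)
proof (induction P rule: finite_induct)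
  case empty
  have "{m. m \<in> {1..N} \<and> prime_factors m \<subseteq> {}} \<subseteq> {1}"
  proof
    fix m assume "m \<in> {m. m \<in> {1..N} \<and> prime_factors m \<subseteq> {}}"
    then have "m > 0" "prime_factors m = {}" by auto
    then show "m \<in> {1}" using prime_factor_nat[of m] by (auto simp: prime_factors_dvd)
  qed
  then have "(\<Sum>m | m \<in> {1..N} \<and> prime_factors m \<subseteq> {}. a m) \<le> (\<Sum>m\<in>{1}. a m)"
    using assms(4) by (intro sum_mono2) auto
  then show ?case using assms(3) by simp
next
  case (insert p P)
  define S where "S = (\<lambda>Q. {m. m \<in> {1..N} \<and> prime_factors m \<subseteq> Q})"
  have fin: "finite (S Q)" for Q by (simp add: S_def)
  have p: "prime p" using insert by simp
  have "(\<Sum>m\<in>S (insert p P). a m) \<le> (\<Sum>(k, m)\<in>{..N} \<times> S P. a (p ^ k) * a m)"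
  proof (rule sum_le_included [where i = "\<lambda>(k, m). p ^ k * m"])
    show "\<forall>n\<in>S (insert p P). \<exists>y\<in>{..N} \<times> S P.
            (case y of (k, m) \<Rightarrow> p ^ k * m) = n \<and> a n \<le> (case y of (k, m) \<Rightarrow> a (p ^ k) * a m)"
    proof
      fix n assume n: "n \<in> S (insert p P)"
      then have n0: "n > 0" "n \<le> N" by (auto simp: S_def)
      obtain k m where m: "n = p ^ k * m" "\<not> p dvd m" "m > 0"
        using p n0(1) by (rule prime_power_decompose)
      \<comment> \<open>A crude bound for the exponent, which allows the same cutoff
        \<open>N\<close> in every Euler factor.\<close>
      have "k < 2 ^ k" by simp
      also have "\<dots> \<le> p ^ k" using p by (intro power_mono) (auto dest: prime_ge_2_nat)
      also have "\<dots> \<le> n" using m n0 by (intro dvd_imp_le) auto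
      finally have "k \<le> N" using n0 by simp
      have "m \<le> n" using m n0 by (intro dvd_imp_le) auto
      moreover have "prime_factors m \<subseteq> P"
      proof
        fix q assume q: "q \<in> prime_factors m"
        then have "q \<in> prime_factors n" using m n0
          by (metis dvd_prime_factors dvd_triv_right less_numeral_extra(3) subsetD)
        moreover have "q \<noteq> p" using q m by auto
        ultimately show "q \<in> P" using n by (auto simp: S_def)
      qed
      ultimately have "m \<in> S P" using \<open>m > 0\<close> n0 by (simp add: S_def)
      moreover have "a n = a (p ^ k) * a m"
        unfolding m(1) using p m \<open>m > 0\<close>
        by (intro mult) (auto simp: prime_gt_0_nat prime_imp_coprime)
      ultimately show "\<exists>y\<in>{..N} \<times> S P.
            (case y of (k, m) \<Rightarrow> p ^ k * m) = n \<and> a n \<le> (case y of (k, m) \<Rightarrow> a (p ^ k) * a m)"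
        using \<open>k \<le> N\<close> m by (intro bexI [of _ "(k, m)"]) auto
    qed
  qed (use fin assms(4) in auto)
  also have "\<dots> = (\<Sum>k\<le>N. a (p ^ k)) * (\<Sum>m\<in>S P. a m)"
    by (simp add: sum_product sum.cartesian_product)
  also have "\<dots> \<le> (\<Sum>k\<le>N. a (p ^ k)) * (\<Prod>p\<in>P. \<Sum>k\<le>N. a (p ^ k))"
    using insert assms(4) by (intro mult_left_mono) (auto simp: S_def sum_nonneg)
  finally show ?case using insert by (simp add: S_def)
qed

text \<open>In the Euler factor of \<open>p\<close> the powers from \<open>p\<^sup>2\<close> on
  contribute at most \<open>2 / p\<^sup>2\<close>, and \<open>1 + v \<le> exp v\<close> moves the
  product into the exponent. The constant 2 is twice the bound 1 for
  \<open>\<Sum> 1 / p\<^sup>2\<close>.\<close>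

lemma sum_multiplicative_le_exp:
  assumes G: "multiplicative_fun G" and le1: "\<And>n. n > 0 \<Longrightarrow> norm (G n) \<le> 1"
  shows "(\<Sum>m\<in>{1..N}. norm (G m) / real m)
           \<le> exp ((\<Sum>p | prime p \<and> p \<le> N. norm (G p) / real p) + 2)"
proof -
  define a where "a = (\<lambda>m. norm (G m) / real m)"
  let ?P = "{p. prime p \<and> p \<le> N}"
  have fin: "finite ?P" by simp
  have a1: "a 1 = 1" and a0: "a n \<ge> 0" for n
    using G by (simp_all add: a_def multiplicative_fun_def)
  have amult: "a (m * n) = a m * a n" if "m > 0" "n > 0" "coprime m n" for m n
    using G that by (simp add: a_def multiplicative_fun_def norm_mult)
  have "(\<Sum>m\<in>{1..N}. a m) = (\<Sum>m | m \<in> {1..N} \<and> prime_factors m \<subseteq> ?P. a m)"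
    by (rule sum.cong) (auto simp: in_prime_factors_iff intro: order_trans [OF dvd_imp_le])
  also have "\<dots> \<le> (\<Prod>p\<in>?P. \<Sum>k\<le>N. a (p ^ k))"
    using fin a1 a0 amult by (intro sum_multiplicative_le_prod) auto
  also have "\<dots> \<le> (\<Prod>p\<in>?P. exp (a p + 2 * (1 / (real p)\<^sup>2)))"
  proof (intro prod_mono conjI sum_nonneg a0)
    fix p assume p: "p \<in> ?P"
    then have p2: "p \<ge> 2" by (auto dest: prime_ge_2_nat)
    with p have "N \<ge> 2" by auto
    then have "{..N} = insert 0 (insert 1 {2..N})" by auto
    then have "(\<Sum>k\<le>N. a (p ^ k)) = 1 + a p + (\<Sum>k\<in>{2..N}. a (p ^ k))"
      using a1 by simp
    also have "(\<Sum>k\<in>{2..N}. a (p ^ k)) \<le> (\<Sum>k\<in>{2..N}. (1 / real p) ^ k)"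
    proof (rule sum_mono)
      fix k
      have "norm (G (p ^ k)) \<le> 1" using p2 by (intro le1) auto
      then show "a (p ^ k) \<le> (1 / real p) ^ k"
        using p2 by (simp add: a_def divide_simps)
    qed
    also have "\<dots> \<le> 2 * (1 / real p)\<^sup>2"
      using p2 by (intro sum_power_le) (auto simp: divide_simps)
    also have "1 + a p + 2 * (1 / real p)\<^sup>2 \<le> exp (a p + 2 * (1 / (real p)\<^sup>2))"
      using exp_ge_add_one_self[of "a p + 2 * (1 / (real p)\<^sup>2)"]
      by (simp add: power_divide algebra_simps)
    finally show "(\<Sum>k\<le>N. a (p ^ k)) \<le> exp (a p + 2 * (1 / (real p)\<^sup>2))" by simp
  qed
  also have "\<dots> = exp ((\<Sum>p\<in>?P. a p) + 2 * (\<Sum>p\<in>?P. 1 / (real p)\<^sup>2))"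
    by (simp only: exp_sum [OF fin, symmetric] sum.distrib sum_distrib_left)
  also have "\<dots> \<le> exp ((\<Sum>p\<in>?P. a p) + 2)"
  proof -
    have "(\<Sum>p\<in>?P. 1 / (real p)\<^sup>2) \<le> (\<Sum>p\<in>{1<..N}. 1 / (real p)\<^sup>2)"
      by (rule sum_mono2) (auto dest: prime_gt_1_nat)
    also have "\<dots> \<le> 1" using sum_inverse_squares_le[of 1 N] by simp
    finally show ?thesis by simp
  qed
  finally show ?thesis by (simp add: a_def)
qed

text \<open>Euler's argument: the previous bound for the constant function 1 has the harmonic sum on
  its left, which is at least \<open>ln (N + 1)\<close>.\<close>

lemma ln_ln_le_sum_inverse_primes:
  fixes N :: nat
  assumes "N > 0"
  shows "ln (ln (real N + 1)) \<le> (\<Sum>p | prime p \<and> p \<le> N. 1 / real p) + 2"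
proof -
  have "ln (real N + 1) \<le> harm N" by (rule ln_le_harm)
  also have "harm N = (\<Sum>m\<in>{1..N}. norm (1::complex) / real m)"
    by (simp add: harm_def divide_inverse)
  also have "\<dots> \<le> exp ((\<Sum>p | prime p \<and> p \<le> N. norm (1::complex) / real p) + 2)"
    by (rule sum_multiplicative_le_exp [of "\<lambda>_. 1"]) (auto simp: multiplicative_fun_def)
  finally have "ln (real N + 1) \<le> exp ((\<Sum>p | prime p \<and> p \<le> N. 1 / real p) + 2)" by simp
  then have "ln (ln (real N + 1)) \<le> ln (exp ((\<Sum>p | prime p \<and> p \<le> N. 1 / real p) + 2))"
    using assms by (intro ln_mono) auto
  then show ?thesis by simp
qed

section \<open>Construction and comparison through values at prime powers\<close>

lemma multiplicative_fun_prod_prime_factors: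
  "multiplicative_fun (\<lambda>n. \<Prod>p\<in>prime_factors n. h p (multiplicity p n))"
  unfolding multiplicative_fun_def
proof (intro conjI allI impI)
  fix m n :: nat
  assume mn: "m > 0" "n > 0" "coprime m n"
  have disj: "prime_factors m \<inter> prime_factors n = {}"
    using mn by (auto simp: in_prime_factors_iff)
       (metis coprime_common_divisor not_prime_unit)
  have "(\<Prod>p\<in>prime_factors (m * n). h p (multiplicity p (m * n)))
      = (\<Prod>p\<in>prime_factors m. h p (multiplicity p (m * n)))
        * (\<Prod>p\<in>prime_factors n. h p (multiplicity p (m * n)))"
    using mn disj by (simp add: prime_factors_product prod.union_disjoint)
  also have "(\<Prod>p\<in>prime_factors m. h p (multiplicity p (m * n)))
      = (\<Prod>p\<in>prime_factors m. h p (multiplicity p m))"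
  proof (rule prod.cong)
    fix p assume "p \<in> prime_factors m"
    then have "prime p" "\<not> p dvd n" using disj mn by (auto simp: in_prime_factors_iff)
    then show "h p (multiplicity p (m * n)) = h p (multiplicity p m)"
      using mn by (simp add: prime_elem_multiplicity_mult_distrib not_dvd_imp_multiplicity_0)
  qed simp
  also have "(\<Prod>p\<in>prime_factors n. h p (multiplicity p (m * n)))
      = (\<Prod>p\<in>prime_factors n. h p (multiplicity p n))"
  proof (rule prod.cong)
    fix p assume "p \<in> prime_factors n"
    then have "prime p" "\<not> p dvd m" using disj mn by (auto simp: in_prime_factors_iff)
    then show "h p (multiplicity p (m * n)) = h p (multiplicity p n)"
      using mn by (simp add: prime_elem_multiplicity_mult_distrib not_dvd_imp_multiplicity_0)
  qed simp
  finally show "(\<Prod>p\<in>prime_factors (m * n). h p (multiplicity p (m * n)))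
      = (\<Prod>p\<in>prime_factors m. h p (multiplicity p m))
        * (\<Prod>p\<in>prime_factors n. h p (multiplicity p n))" .
qed simp

text \<open>Only primes dividing this particular \<open>n\<close> are compared, since hybrids at
  different levels, or a hybrid and \<open>f\<close>, agree at some integers but not at all.\<close>

lemma multiplicative_fun_eqI:
  assumes f: "multiplicative_fun f" and g: "multiplicative_fun g"
    and eq: "\<And>p k. prime p \<Longrightarrow> p dvd n \<Longrightarrow> k > 0 \<Longrightarrow> f (p ^ k) = g (p ^ k)" and "n > 0"
  shows "f n = g n"
  using eq \<open>n > 0\<close>
proof (induction n rule: less_induct)
  case (less n)
  show ?case
  proof (cases "n = 1")
    case True
    with f g show ?thesis by (simp add: multiplicative_fun_def)
  next
    case False
    then obtain p where p: "prime p" "p dvd n" using prime_factor_nat by blast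
    with less.prems obtain k m where m: "n = p ^ k * m" "\<not> p dvd m" and m0: "m > 0"
      by (metis prime_power_decompose)
    have k: "k > 0" using p m by (auto intro!: gr0I)
    have "p ^ k > 1" using p k by (intro one_less_power) (auto dest: prime_gt_1_nat)
    then have "m < n" using m m0 by simp
    moreover have "q dvd n" if "q dvd m" for q using that m by (metis dvd_mult)
    ultimately have "f m = g m" using less m0 by auto
    moreover have "coprime (p ^ k) m" using p m by (simp add: prime_imp_coprime)
    moreover have "f (p ^ k) = g (p ^ k)" using less.prems p k by simp
    ultimately show ?thesis using f g m(1) m0 p
      by (metis multiplicative_fun_def prime_gt_0_nat zero_less_power)
  qed
qed

subsection \<open>Interpolation between \<open>f\<close> and its model\<close>

text \<open>For \<open>t \<ge> n\<close> the value at \<open>n\<close> is \<open>f n\<close>. Using \<open>\<rho> ^ k\<close> rather than \<open>\<rho>\<close> at \<open>p ^ k\<close> makes the function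
  completely multiplicative at the primes above \<open>t\<close>, so that pulling out a large prime needs no
  coprimality.\<close>

definition hybrid :: "(nat \<Rightarrow> complex) \<Rightarrow> complex \<Rightarrow> nat \<Rightarrow> nat \<Rightarrow> complex" where
  "hybrid f \<rho> t n =
     (\<Prod>p\<in>prime_factors n. if p \<le> t then f (p ^ multiplicity p n) else \<rho> ^ multiplicity p n)"

lemma multiplicative_hybrid: "multiplicative_fun (hybrid f \<rho> t)"
  unfolding hybrid_def
  by (rule multiplicative_fun_prod_prime_factors
      [of "\<lambda>p k. if p \<le> t then f (p ^ k) else \<rho> ^ k"])

lemma hybrid_mult:
  "m > 0 \<Longrightarrow> n > 0 \<Longrightarrow> coprime m n \<Longrightarrow> hybrid f \<rho> t (m * n) = hybrid f \<rho> t m * hybrid f \<rho> t n"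
  using multiplicative_hybrid by (simp add: multiplicative_fun_def)

lemma hybrid_prime_power:
  assumes "prime p" "k > 0"
  shows "hybrid f \<rho> t (p ^ k) = (if p \<le> t then f (p ^ k) else \<rho> ^ k)"
  using assms by (simp add: hybrid_def prime_factorization_prime_power)

lemma hybrid_prime:
  assumes "prime p"
  shows "hybrid f \<rho> t p = (if p \<le> t then f p else \<rho>)"
  using hybrid_prime_power[OF assms, of 1] by simp

lemma norm_hybrid_le:
  assumes "\<And>n. n > 0 \<Longrightarrow> norm (f n) \<le> 1" "norm \<rho> \<le> 1"
  shows "norm (hybrid f \<rho> t n) \<le> 1"
  unfolding hybrid_def prod_norm [symmetric]
  by (rule prod_le_1)
     (use assms in \<open>auto simp: norm_power power_le_one in_prime_factors_iff prime_gt_0_nat\<close>)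

lemma hybrid_eq:
  assumes "multiplicative_fun f" "0 < n" "n \<le> t"
  shows "hybrid f \<rho> t n = f n"
proof (rule multiplicative_fun_eqI [OF multiplicative_hybrid assms(1)])
  fix p k :: nat assume p: "prime p" "p dvd n" "k > 0"
  then have "p \<le> t" using assms by (meson dvd_imp_le order_trans)
  with p show "hybrid f \<rho> t (p ^ k) = f (p ^ k)" by (simp add: hybrid_prime_power)
qed (use assms in auto)

lemma hybrid_Suc_eq:
  assumes "n > 0" "\<not> (prime (Suc t) \<and> Suc t dvd n)"
  shows "hybrid f \<rho> (Suc t) n = hybrid f \<rho> t n"
proof (rule multiplicative_fun_eqI [OF multiplicative_hybrid multiplicative_hybrid])
  fix p k :: nat assume "prime p" "p dvd n" "k > 0"
  moreover from this have "p \<noteq> Suc t" using assms by auto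
  ultimately show "hybrid f \<rho> (Suc t) (p ^ k) = hybrid f \<rho> t (p ^ k)"
    by (simp add: hybrid_prime_power)
qed (use assms in auto)

lemma hybrid_Suc_diff:
  assumes "w > 0" "prime (Suc t)" "\<not> Suc t dvd w"
  shows "hybrid f \<rho> (Suc t) (Suc t * w) - hybrid f \<rho> t (Suc t * w)
           = (f (Suc t) - \<rho>) * hybrid f \<rho> (Suc t) w"
proof -
  have "coprime (Suc t) w" using assms by (simp add: prime_imp_coprime)
  then have "hybrid f \<rho> u (Suc t * w) = hybrid f \<rho> u (Suc t) * hybrid f \<rho> u w" for u
    using assms by (intro hybrid_mult) auto
  moreover have "hybrid f \<rho> (Suc t) w = hybrid f \<rho> t w"
    using assms by (intro hybrid_Suc_eq) auto
  ultimately show ?thesis using assms by (simp add: hybrid_prime algebra_simps)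
qed

text \<open>\<open>m\<close> may itself contain \<open>p\<close>. Raising the exponent of
  \<open>p\<close> by one multiplies the value by \<open>\<rho>\<close> in every case, because the
  value at \<open>p ^ j\<close> is \<open>\<rho> ^ j\<close> also for \<open>j = 0\<close>.\<close>

lemma hybrid_mult_prime:
  assumes "prime p" "t < p" "m > 0"
  shows "hybrid f \<rho> t (p * m) = \<rho> * hybrid f \<rho> t m"
proof -
  obtain k w where w: "m = p ^ k * w" "\<not> p dvd w" "w > 0"
    using assms by (metis prime_power_decompose)
  have "coprime (p ^ j) w" for j using assms w by (simp add: prime_imp_coprime)
  then have 1: "hybrid f \<rho> t (p ^ j * w) = hybrid f \<rho> t (p ^ j) * hybrid f \<rho> t w" for j
    using assms w by (intro hybrid_mult) (auto simp: prime_gt_0_nat)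
  have 2: "hybrid f \<rho> t (p ^ j) = \<rho> ^ j" for j
    using assms hybrid_prime_power[of p j f \<rho> t] by (cases "j = 0") (auto simp: hybrid_def)
  have "p * m = p ^ Suc k * w" using w(1) by simp
  then show ?thesis using 1[of "Suc k"] 1[of k] 2[of "Suc k"] 2[of k] w(1)
    by (simp add: mult.assoc)
qed

subsection \<open>Comparison of mean values\<close>

lemma harm_le_ln: "N > 0 \<Longrightarrow> harm N \<le> 1 + ln (real N)"
proof (induction N rule: nat_induct_non_zero)
  case 1
  show ?case by (simp add: harm_def)
next
  case (Suc N)
  have "ln (real N / real (Suc N)) \<le> real N / real (Suc N) - 1"
    using Suc by (intro ln_le_minus_one) simp
  then have "inverse (real (Suc N)) \<le> ln (real (Suc N)) - ln (real N)"
    using Suc by (simp add: ln_div field_simps)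
  with Suc show ?case by (simp add: harm_Suc)
qed

text \<open>Both sides run over the lattice points under the hyperbola
  \<open>s * w \<le> N\<close>.\<close>

lemma sum_le_div_swap:
  fixes h :: "nat \<Rightarrow> nat \<Rightarrow> 'a :: comm_monoid_add"
  shows "(\<Sum>s\<in>{1..N}. \<Sum>w\<in>{1..N div s}. h s w) = (\<Sum>w\<in>{1..N}. \<Sum>s\<in>{1..N div w}. h s w)"
proof -
  have *: "{1..N div s} = {w. w \<in> {1..N} \<and> s * w \<le> N}" if "s \<in> {1..N}" for s
  proof (intro set_eqI iffI)
    fix w assume w: "w \<in> {1..N div s}"
    then have "w \<le> N" by (auto intro: order_trans [OF _ div_le_dividend])
    with w show "w \<in> {w. w \<in> {1..N} \<and> s * w \<le> N}"
      using that by (simp add: less_eq_div_iff_mult_less_eq mult.commute)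
  next
    fix w assume "w \<in> {w. w \<in> {1..N} \<and> s * w \<le> N}"
    then show "w \<in> {1..N div s}"
      using that by (auto simp: less_eq_div_iff_mult_less_eq mult.commute)
  qed
  have "(\<Sum>s\<in>{1..N}. \<Sum>w\<in>{1..N div s}. h s w)
      = (\<Sum>s\<in>{1..N}. \<Sum>w | w \<in> {1..N} \<and> s * w \<le> N. h s w)"
    using * by (intro sum.cong) auto
  also have "\<dots> = (\<Sum>w\<in>{1..N}. \<Sum>s | s \<in> {1..N} \<and> s * w \<le> N. h s w)"
    by (rule sum.swap_restrict) auto
  also have "\<dots> = (\<Sum>w\<in>{1..N}. \<Sum>s\<in>{1..N div w}. h s w)"
    using * by (intro sum.cong) (auto simp: mult.commute)
  finally show ?thesis .
qed

text \<open>Writing \<open>w = d * k\<close> for each divisor \<open>d\<close> and relaxing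
  \<open>d * k \<le> N\<close> to \<open>k \<le> N\<close> bounds the sum by the square of a
  harmonic sum.\<close>

lemma sum_divisor_count_le:
  fixes N :: nat
  assumes "N > 0"
  shows "(\<Sum>w\<in>{1..N}. real (card {d. d dvd w}) / real w) \<le> (1 + ln (real N))\<^sup>2"
proof -
  have "(\<Sum>w\<in>{1..N}. real (card {d. d dvd w}) / real w)
      = (\<Sum>w\<in>{1..N}. \<Sum>d | d \<in> {1..N} \<and> d dvd w. 1 / real w)"
  proof (rule sum.cong)
    fix w assume w: "w \<in> {1..N}"
    then have "{d. d dvd w} = {d. d \<in> {1..N} \<and> d dvd w}"
      by (auto intro: order_trans [OF dvd_imp_le] Suc_leI dvd_pos_nat)
    then show "real (card {d. d dvd w}) / real w = (\<Sum>d | d \<in> {1..N} \<and> d dvd w. 1 / real w)"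
      by simp
  qed simp
  also have "\<dots> = (\<Sum>d\<in>{1..N}. \<Sum>w | w \<in> {1..N} \<and> d dvd w. 1 / real w)"
    by (rule sum.swap_restrict) auto
  also have "\<dots> = (\<Sum>d\<in>{1..N}. \<Sum>k\<in>{1..N div d}. 1 / real d * (1 / real k))"
  proof (rule sum.cong)
    fix d assume "d \<in> {1..N}"
    then show "(\<Sum>w | w \<in> {1..N} \<and> d dvd w. 1 / real w) = (\<Sum>k\<in>{1..N div d}. 1 / real d * (1 / real k))"
      using sum_multiples[of d "\<lambda>w. 1 / real w" N] by simp
  qed simp
  also have "\<dots> \<le> (\<Sum>d\<in>{1..N}. \<Sum>k\<in>{1..N}. 1 / real d * (1 / real k))"
    by (intro sum_mono sum_mono2) (auto intro: order_trans [OF _ div_le_dividend])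
  also have "\<dots> = harm N ^ 2"
    by (simp add: sum_product harm_def power2_eq_square divide_inverse)
  also have "\<dots> \<le> (1 + ln (real N))\<^sup>2"
    using assms by (intro power_mono harm_le_ln harm_nonneg) auto
  finally show ?thesis .
qed

text \<open>Abel summation: the sum is controlled by the partial sums of \<open>c\<close> and the
  total variation of \<open>b\<close>.\<close>

lemma norm_sum_mult_le_variation:
  fixes c b :: "nat \<Rightarrow> complex"
  assumes S: "\<And>k. k \<le> L \<Longrightarrow> norm (\<Sum>t\<in>{1..k}. c t) \<le> B" and b: "\<And>t. norm (b t) \<le> 1"
  shows "norm (\<Sum>t\<in>{1..L}. c t * b t) \<le> B * (1 + (\<Sum>t\<in>{1..<L}. norm (b t - b (Suc t))))"
proof -
  have eq: "(\<Sum>t\<in>{1..k}. c t * b t)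
      = (\<Sum>t\<in>{1..k}. c t) * b k + (\<Sum>t\<in>{1..<k}. (\<Sum>t\<in>{1..t}. c t) * (b t - b (Suc t)))" for k
  proof (induction k)
    case (Suc k)
    show ?case
    proof (cases "k = 0")
      case False
      then have "{1..<Suc k} = insert k {1..<k}" by auto
      with Suc show ?thesis by (simp add: algebra_simps)
    qed simp
  qed simp
  have "B \<ge> 0" using S[of 0] by simp
  have "norm (\<Sum>t\<in>{1..L}. c t * b t) \<le> norm ((\<Sum>t\<in>{1..L}. c t) * b L)
          + (\<Sum>t\<in>{1..<L}. norm ((\<Sum>t\<in>{1..t}. c t) * (b t - b (Suc t))))"
    unfolding eq by (rule norm_triangle_le) (simp add: norm_sum)
  also have "\<dots> \<le> B * 1 + (\<Sum>t\<in>{1..<L}. B * norm (b t - b (Suc t)))"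
    unfolding norm_mult using S b \<open>B \<ge> 0\<close>
    by (intro add_mono sum_mono mult_mono mult_right_mono) auto
  also have "\<dots> = B * (1 + (\<Sum>t\<in>{1..<L}. norm (b t - b (Suc t))))"
    by (simp add: sum_distrib_left algebra_simps)
  finally show ?thesis .
qed

text \<open>Only multiples \<open>s * w\<close> of a prime \<open>s\<close> change their value.
  Those with \<open>s\<close> not dividing \<open>w\<close> give exactly the main term; the others
  are multiples of \<open>s\<^sup>2\<close>, at most \<open>N / s\<^sup>2\<close> in number, each
  costing at most 2.\<close>

lemma sum_hybrid_Suc_diff:
  fixes f :: "nat \<Rightarrow> complex"
  assumes f: "\<And>n. n > 0 \<Longrightarrow> norm (f n) \<le> 1" and \<rho>: "norm \<rho> \<le> 1" and s: "s = Suc t"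
  shows "norm ((\<Sum>n\<in>{1..N}. hybrid f \<rho> s n - hybrid f \<rho> t n)
           - (if prime s then f s - \<rho> else 0)
             * (\<Sum>w\<in>{1..N div s}. if s dvd w then 0 else hybrid f \<rho> s w))
         \<le> 2 * real N * (1 / (real s)\<^sup>2)"
proof (cases "prime s")
  case False
  then have "(\<Sum>n\<in>{1..N}. hybrid f \<rho> s n - hybrid f \<rho> t n) = 0"
    unfolding s by (intro sum.neutral) (auto simp: hybrid_Suc_eq)
  with False show ?thesis by simp
next
  case True
  have "(\<Sum>n\<in>{1..N}. hybrid f \<rho> s n - hybrid f \<rho> t n)
      = (\<Sum>n | n \<in> {1..N} \<and> s dvd n. hybrid f \<rho> s n - hybrid f \<rho> t n)"
    unfolding s by (intro sum.mono_neutral_right) (auto simp: hybrid_Suc_eq)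
  also have "\<dots> = (\<Sum>w\<in>{1..N div s}. hybrid f \<rho> s (s * w) - hybrid f \<rho> t (s * w))"
    using s by (intro sum_multiples) simp
  finally have "norm ((\<Sum>n\<in>{1..N}. hybrid f \<rho> s n - hybrid f \<rho> t n)
           - (if prime s then f s - \<rho> else 0)
             * (\<Sum>w\<in>{1..N div s}. if s dvd w then 0 else hybrid f \<rho> s w))
      = norm (\<Sum>w\<in>{1..N div s}. hybrid f \<rho> s (s * w) - hybrid f \<rho> t (s * w)
           - (f s - \<rho>) * (if s dvd w then 0 else hybrid f \<rho> s w))"
    using True by (simp add: sum_subtractf sum_distrib_left)
  also have "\<dots> \<le> (\<Sum>w\<in>{1..N div s}. if s dvd w then 2 else 0)"
  proof (rule sum_norm_le)
    fix w assume w: "w \<in> {1..N div s}"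
    show "norm (hybrid f \<rho> s (s * w) - hybrid f \<rho> t (s * w)
            - (f s - \<rho>) * (if s dvd w then 0 else hybrid f \<rho> s w)) \<le> (if s dvd w then 2 else 0)"
    proof (cases "s dvd w")
      case True
      have "norm (hybrid f \<rho> s (s * w) - hybrid f \<rho> t (s * w)) \<le> 1 + 1"
        by (intro norm_triangle_le_diff add_mono norm_hybrid_le f \<rho>)
      with True show ?thesis by simp
    next
      case False
      then show ?thesis using hybrid_Suc_diff[of w t f \<rho>] w \<open>prime s\<close> by (simp add: s)
    qed
  qed
  also have "\<dots> = 2 * real (N div s div s)"
    using sum_multiples[of s "\<lambda>_. 2 :: real" "N div s"] s by (simp flip: sum.inter_filter)
  also have "\<dots> \<le> 2 * real N * (1 / (real s)\<^sup>2)"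
    using of_nat_div_le_of_nat[where 'a = real, of N "s * s"] by (simp add: div_mult2_eq power2_eq_square)
  finally show ?thesis .
qed

text \<open>A jump between \<open>s\<close> and \<open>Suc s\<close> occurs only if one of them
  divides \<open>w\<close>, and has size at most 2. Each of the two cases arises for at most as many
  \<open>s\<close> as \<open>w\<close> has divisors.\<close>

lemma sum_hybrid_variation_le:
  fixes f :: "nat \<Rightarrow> complex"
  assumes f: "\<And>n. n > 0 \<Longrightarrow> norm (f n) \<le> 1" and \<rho>: "norm \<rho> \<le> 1" and "w > 0"
  defines "b \<equiv> \<lambda>s. if s dvd w then 0 else hybrid f \<rho> s w"
  shows "(\<Sum>s\<in>{1..<L}. norm (b s - b (Suc s))) \<le> 4 * real (card {d. d dvd w})"
proof -
  have fin: "finite {d. d dvd w}" using \<open>w > 0\<close> by simp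
  have b1: "norm (b s) \<le> 1" for s
    using norm_hybrid_le[of f \<rho> s w] f \<rho> by (simp add: b_def)
  have "norm (b s - b (Suc s)) \<le> 2 * of_bool (s dvd w) + 2 * of_bool (Suc s dvd w)" for s
  proof (cases "s dvd w \<or> Suc s dvd w")
    case True
    have "norm (b s - b (Suc s)) \<le> 1 + 1" by (intro norm_triangle_le_diff add_mono b1)
    with True show ?thesis by (auto simp: of_bool_def)
  next
    case False
    then show ?thesis using hybrid_Suc_eq[of w s f \<rho>] \<open>w > 0\<close> by (simp add: b_def)
  qed
  then have "(\<Sum>s\<in>{1..<L}. norm (b s - b (Suc s)))
      \<le> (\<Sum>s\<in>{1..<L}. 2 * of_bool (s dvd w) + 2 * of_bool (Suc s dvd w))"
    by (rule sum_mono)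
  also have "\<dots> = 2 * real (card {s \<in> {1..<L}. s dvd w}) + 2 * real (card {s \<in> {1..<L}. Suc s dvd w})"
    by (simp add: sum.distrib of_bool_def Int_def flip: sum_distrib_left sum.inter_filter)
  also have "\<dots> \<le> 2 * real (card {d. d dvd w}) + 2 * real (card {d. d dvd w})"
  proof -
    have "card {s \<in> {1..<L}. s dvd w} \<le> card {d. d dvd w}"
      using fin by (rule card_mono) auto
    moreover have "card {s \<in> {1..<L}. Suc s dvd w} \<le> card {d. d dvd w}"
      using fin by (intro card_inj_on_le [of Suc]) auto
    ultimately show ?thesis by simp
  qed
  finally show ?thesis by simp
qed

lemma norm_sum_diff_hybrid_le:
  fixes f :: "nat \<Rightarrow> complex"
  assumes mult: "multiplicative_fun f"
    and f: "\<And>n. n > 0 \<Longrightarrow> norm (f n) \<le> 1" and \<rho>: "norm \<rho> \<le> 1"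
    and t0: "t0 > 0" "t0 \<le> N"
    and B: "\<And>k. k \<le> N \<Longrightarrow> norm (\<Sum>p | prime p \<and> t0 < p \<and> p \<le> k. f p - \<rho>) \<le> B * real k"
  shows "norm ((\<Sum>n\<in>{1..N}. f n) - (\<Sum>n\<in>{1..N}. hybrid f \<rho> t0 n))
           \<le> 5 * B * real N * (1 + ln (real N))\<^sup>2 + 2 * real N / real t0"
proof -
  define c where "c = (\<lambda>s. if prime s \<and> t0 < s then f s - \<rho> else 0)"
  define b where "b = (\<lambda>w s. if s dvd w then 0 else hybrid f \<rho> s w)"
  define D where "D = (\<lambda>s. \<Sum>n\<in>{1..N}. hybrid f \<rho> s n - hybrid f \<rho> (s - 1) n)"
  have B0: "B \<ge> 0"
  proof -
    have "0 \<le> B * real N" using B[of N] by (intro order_trans [OF norm_ge_zero]) auto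
    then show ?thesis using t0 by (simp add: zero_le_mult_iff)
  qed
  \<comment> \<open>At level \<open>N\<close> the hybrid is \<open>f\<close> itself on
    \<open>{1..N}\<close>, so the difference telescopes over the levels.\<close>
  have "(\<Sum>n\<in>{1..N}. f n) - (\<Sum>n\<in>{1..N}. hybrid f \<rho> t0 n)
      = (\<Sum>n\<in>{1..N}. hybrid f \<rho> N n - hybrid f \<rho> t0 n)"
    using mult by (simp add: hybrid_eq sum_subtractf)
  also have "\<dots> = (\<Sum>n\<in>{1..N}. \<Sum>t\<in>{t0..<N}. hybrid f \<rho> (Suc t) n - hybrid f \<rho> t n)"
    by (intro sum.cong refl sum_Suc_diff' [OF t0(2), symmetric])
  also have "\<dots> = (\<Sum>t\<in>{t0..<N}. D (Suc t))"
    by (subst sum.swap) (simp add: D_def)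
  also have "\<dots> = (\<Sum>s\<in>{t0<..N}. D s)"
    by (rule sum.reindex_bij_witness [where i = "\<lambda>s. s - 1" and j = Suc]) auto
  finally have eq: "(\<Sum>n\<in>{1..N}. f n) - (\<Sum>n\<in>{1..N}. hybrid f \<rho> t0 n) = (\<Sum>s\<in>{t0<..N}. D s)" .
  have "norm ((\<Sum>s\<in>{t0<..N}. D s) - (\<Sum>s\<in>{t0<..N}. c s * (\<Sum>w\<in>{1..N div s}. b w s)))
      \<le> (\<Sum>s\<in>{t0<..N}. 2 * real N * (1 / (real s)\<^sup>2))"
    unfolding sum_subtractf [symmetric]
  proof (rule sum_norm_le)
    fix s assume "s \<in> {t0<..N}"
    then show "norm (D s - c s * (\<Sum>w\<in>{1..N div s}. b w s)) \<le> 2 * real N * (1 / (real s)\<^sup>2)"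
      using sum_hybrid_Suc_diff[of f \<rho> s "s - 1" N] f \<rho> by (simp add: D_def c_def b_def)
  qed
  also have "\<dots> \<le> 2 * real N * (1 / real t0)"
    unfolding sum_distrib_left [symmetric]
    using t0 by (intro mult_left_mono sum_inverse_squares_le) auto
  finally have 1: "norm ((\<Sum>s\<in>{t0<..N}. D s) - (\<Sum>s\<in>{t0<..N}. c s * (\<Sum>w\<in>{1..N div s}. b w s)))
      \<le> 2 * real N / real t0" by simp
  \<comment> \<open>As \<open>c\<close> vanishes up to \<open>t0\<close>, the range of
    \<open>s\<close> may start at 1, which makes the region symmetric in \<open>s\<close> and
    \<open>w\<close>.\<close>
  have "(\<Sum>s\<in>{t0<..N}. c s * (\<Sum>w\<in>{1..N div s}. b w s))
      = (\<Sum>s\<in>{1..N}. \<Sum>w\<in>{1..N div s}. c s * b w s)"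
    unfolding sum_distrib_left by (rule sum.mono_neutral_left) (auto simp: c_def)
  also have "\<dots> = (\<Sum>w\<in>{1..N}. \<Sum>s\<in>{1..N div w}. c s * b w s)" by (rule sum_le_div_swap)
  finally have "norm (\<Sum>s\<in>{t0<..N}. c s * (\<Sum>w\<in>{1..N div s}. b w s))
      = norm (\<Sum>w\<in>{1..N}. \<Sum>s\<in>{1..N div w}. c s * b w s)" by simp
  also have "\<dots> \<le> (\<Sum>w\<in>{1..N}. 5 * B * real N * (real (card {d. d dvd w}) / real w))"
  proof (rule sum_norm_le)
    fix w assume w: "w \<in> {1..N}"
    have S: "norm (\<Sum>s\<in>{1..k}. c s) \<le> B * (real N / real w)" if k: "k \<le> N div w" for k
    proof -
      have "(\<Sum>s\<in>{1..k}. c s) = (\<Sum>p | prime p \<and> t0 < p \<and> p \<le> k. f p - \<rho>)"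
        unfolding c_def sum.inter_filter [symmetric, OF finite_atLeastAtMost]
        by (rule sum.cong) auto
      also have "norm \<dots> \<le> B * real k"
        using k div_le_dividend[of N w] by (intro B) linarith
      also have "\<dots> \<le> B * (real N / real w)"
        using B0 k of_nat_div_le_of_nat[where 'a = real, of N w] by (intro mult_left_mono) auto
      finally show ?thesis .
    qed
    have b1: "norm (b w s) \<le> 1" for s
      using norm_hybrid_le[of f \<rho> s w] f \<rho> by (simp add: b_def)
    have var: "(\<Sum>s\<in>{1..<N div w}. norm (b w s - b w (Suc s))) \<le> 4 * real (card {d. d dvd w})"
      unfolding b_def using w by (intro sum_hybrid_variation_le f \<rho>) auto
    have "card {d. d dvd w} > 0" using w by (subst card_gt_0_iff) auto
    then have d1: "real (card {d. d dvd w}) \<ge> 1" by linarith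
    have "norm (\<Sum>s\<in>{1..N div w}. c s * b w s)
        \<le> B * (real N / real w) * (1 + (\<Sum>s\<in>{1..<N div w}. norm (b w s - b w (Suc s))))"
      by (intro norm_sum_mult_le_variation S b1)
    \<comment> \<open>The 1 is absorbed into the divisor count, which is at least 1.\<close>
    also have "\<dots> \<le> B * (real N / real w) * (5 * real (card {d. d dvd w}))"
      using var d1 B0 by (intro mult_left_mono) auto
    finally show "norm (\<Sum>s\<in>{1..N div w}. c s * b w s)
        \<le> 5 * B * real N * (real (card {d. d dvd w}) / real w)" by (simp add: mult_ac)
  qed
  also have "\<dots> \<le> 5 * B * real N * (1 + ln (real N))\<^sup>2"
    unfolding sum_distrib_left [symmetric]
    using t0 B0 by (intro mult_left_mono sum_divisor_count_le) auto
  finally show ?thesis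
    using 1 norm_triangle_sub[of "\<Sum>s\<in>{t0<..N}. D s" "\<Sum>s\<in>{t0<..N}. c s * (\<Sum>w\<in>{1..N div s}. b w s)"]
    unfolding eq by linarith
qed

section \<open>Integers with a prime factor above \<open>z\<close>\<close>

lemma sum_norm_hybrid_not_smooth_le:
  fixes f :: "nat \<Rightarrow> complex"
  assumes "z > 1" "real t0 \<le> z"
  shows "(\<Sum>n | n \<in> {1..N} \<and> \<not> smooth_nat z n. norm (hybrid f \<rho> t0 n))
           \<le> norm \<rho> * real N * (ln 4 / ln z) * (\<Sum>m\<in>{1..N}. norm (hybrid f \<rho> t0 m) / real m)"
proof -
  let ?g = "hybrid f \<rho> t0"
  define Q where "Q = {p. prime p \<and> z < real p \<and> p \<le> N}"
  have "finite Q" by (simp add: Q_def)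
  \<comment> \<open>Each \<open>n\<close> is counted once for every prime factor above
    \<open>z\<close>; such overcounting is harmless for an upper bound.\<close>
  have "(\<Sum>n | n \<in> {1..N} \<and> \<not> smooth_nat z n. norm (?g n))
      \<le> (\<Sum>n | n \<in> {1..N} \<and> \<not> smooth_nat z n. \<Sum>p | p \<in> Q \<and> p dvd n. norm (?g n))"
  proof (rule sum_mono)
    fix n assume n: "n \<in> {n. n \<in> {1..N} \<and> \<not> smooth_nat z n}"
    then obtain p where p: "prime p" "p dvd n" "z < real p" by (auto simp: smooth_nat_def)
    then have "p \<in> Q" using n by (auto simp: Q_def intro: order_trans [OF dvd_imp_le])
    then have "norm (?g n) = (\<Sum>q\<in>{p}. norm (?g n))" by simp
    also have "\<dots> \<le> (\<Sum>p | p \<in> Q \<and> p dvd n. norm (?g n))"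
      using p \<open>p \<in> Q\<close> \<open>finite Q\<close> by (intro sum_mono2) auto
    finally show "norm (?g n) \<le> (\<Sum>p | p \<in> Q \<and> p dvd n. norm (?g n))" .
  qed
  also have "\<dots> \<le> (\<Sum>n\<in>{1..N}. \<Sum>p | p \<in> Q \<and> p dvd n. norm (?g n))"
    by (rule sum_mono2) (auto intro: sum_nonneg)
  also have "\<dots> = (\<Sum>p\<in>Q. \<Sum>n | n \<in> {1..N} \<and> p dvd n. norm (?g n))"
    using \<open>finite Q\<close> by (intro sum.swap_restrict) auto
  also have "\<dots> = (\<Sum>p\<in>Q. \<Sum>m\<in>{1..N div p}. norm (?g (p * m)))"
    by (intro sum.cong refl sum_multiples) (auto simp: Q_def prime_gt_0_nat)
  also have "\<dots> = (\<Sum>p\<in>Q. \<Sum>m\<in>{1..N div p}. norm \<rho> * norm (?g m))"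
  proof (intro sum.cong refl)
    fix p m assume pm: "p \<in> Q" "m \<in> {1..N div p}"
    then have "prime p" "t0 < p" using assms by (auto simp: Q_def)
    with pm show "norm (?g (p * m)) = norm \<rho> * norm (?g m)"
      by (simp add: hybrid_mult_prime norm_mult)
  qed
  also have "\<dots> = (\<Sum>p\<in>{1..N}. \<Sum>m\<in>{1..N div p}. if p \<in> Q then norm \<rho> * norm (?g m) else 0)"
  proof (rule sum.mono_neutral_cong_left)
    show "Q \<subseteq> {1..N}" by (auto simp: Q_def prime_gt_0_nat Suc_leI)
  qed auto
  also have "\<dots> = (\<Sum>m\<in>{1..N}. \<Sum>p\<in>{1..N div m}. if p \<in> Q then norm \<rho> * norm (?g m) else 0)"
    by (rule sum_le_div_swap)
  also have "\<dots> \<le> (\<Sum>m\<in>{1..N}. norm \<rho> * real N * (ln 4 / ln z) * (norm (?g m) / real m))"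
  proof (rule sum_mono)
    fix m assume m: "m \<in> {1..N}"
    define R where "R = {p \<in> {1..N div m}. p \<in> Q}"
    \<comment> \<open>Every prime in \<open>R\<close> exceeds \<open>z\<close>, so Chebyshev's bound
      at \<open>N div m\<close> counts them with a saving of \<open>ln z\<close>.\<close>
    have "real (card R) * ln z = (\<Sum>p\<in>R. ln z)" by simp
    also have "\<dots> \<le> (\<Sum>p\<in>R. ln (real p))"
      using assms by (intro sum_mono) (auto simp: R_def Q_def)
    also have "\<dots> \<le> (\<Sum>p | prime p \<and> p \<le> N div m. ln (real p))"
      by (rule sum_mono2) (auto simp: R_def Q_def intro!: ln_ge_zero dest: prime_gt_0_nat)
    also have "\<dots> \<le> real (N div m) * ln 4" by (rule sum_ln_primes_le)
    also have "\<dots> \<le> real N / real m * ln 4"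
      using of_nat_div_le_of_nat[where 'a = real, of N m] by (intro mult_right_mono) auto
    finally have "real (card R) \<le> real N / real m * ln 4 / ln z"
      using assms by (subst pos_le_divide_eq) auto
    then have "real (card R) * (norm \<rho> * norm (?g m))
        \<le> real N / real m * ln 4 / ln z * (norm \<rho> * norm (?g m))"
      by (intro mult_right_mono) auto
    moreover have "(\<Sum>p\<in>{1..N div m}. if p \<in> Q then norm \<rho> * norm (?g m) else 0)
        = real (card R) * (norm \<rho> * norm (?g m))"
      by (simp add: R_def flip: sum.inter_filter)
    ultimately show "(\<Sum>p\<in>{1..N div m}. if p \<in> Q then norm \<rho> * norm (?g m) else 0)
        \<le> norm \<rho> * real N * (ln 4 / ln z) * (norm (?g m) / real m)"
      by (simp add: mult_ac)
  qed
  also have "\<dots> = norm \<rho> * real N * (ln 4 / ln z) * (\<Sum>m\<in>{1..N}. norm (?g m) / real m)"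
    by (simp add: sum_distrib_left)
  finally show ?thesis .
qed

text \<open>In the Euler product bound the primes up to \<open>t0\<close> give the sum over
  \<open>f\<close>, the others \<open>norm \<rho>\<close> times a difference of two Mertens sums.
  Its error is 4 + 2 = 6, and the Euler product adds 2, whence \<open>exp 8\<close>.\<close>

lemma sum_norm_hybrid_div_le:
  fixes f :: "nat \<Rightarrow> complex"
  assumes f: "\<And>n. n > 0 \<Longrightarrow> norm (f n) \<le> 1" and \<rho>: "norm \<rho> \<le> 1"
    and t0: "2 \<le> t0" "t0 \<le> N"
  shows "(\<Sum>m\<in>{1..N}. norm (hybrid f \<rho> t0 m) / real m)
           \<le> exp 8 * exp (\<Sum>p | prime p \<and> p \<le> t0. norm (f p) / real p)
               * (ln (real N) / ln (real t0 + 1)) powr norm \<rho>"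
proof -
  let ?F = "\<Sum>p | prime p \<and> p \<le> t0. norm (f p) / real p"
  let ?r = "\<lambda>n. \<Sum>p | prime p \<and> p \<le> n. 1 / real p"
  have l: "ln (real N) > 0" "ln (real t0 + 1) > 0" using t0 by auto
  have *: "(\<Sum>p | prime p \<and> p \<le> N. h p)
      = (\<Sum>p | prime p \<and> p \<le> t0. h p) + (\<Sum>p | prime p \<and> t0 < p \<and> p \<le> N. h p)"
    for h :: "nat \<Rightarrow> real"
  proof -
    have "{p. prime p \<and> p \<le> N} = {p. prime p \<and> p \<le> t0} \<union> {p. prime p \<and> t0 < p \<and> p \<le> N}"
      using t0 by auto
    then show ?thesis by (simp add: sum.union_disjoint disjoint_iff)
  qed
  have "(\<Sum>p | prime p \<and> t0 < p \<and> p \<le> N. norm (hybrid f \<rho> t0 p) / real p)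
      = norm \<rho> * (?r N - ?r t0)"
    by (simp add: * [of "\<lambda>p. 1 / real p"] hybrid_prime sum_distrib_left)
  also have "\<dots> \<le> norm \<rho> * ((ln (ln (real N)) + 4) - (ln (ln (real t0 + 1)) - 2))"
    using sum_inverse_primes_le[of N] ln_ln_le_sum_inverse_primes[of t0] t0
    by (intro mult_left_mono) auto
  also have "\<dots> = norm \<rho> * ln (ln (real N) / ln (real t0 + 1)) + norm \<rho> * 6"
    using l by (simp add: ln_div algebra_simps)
  also have "\<dots> \<le> norm \<rho> * ln (ln (real N) / ln (real t0 + 1)) + 6" using \<rho> by simp
  finally have "(\<Sum>p | prime p \<and> p \<le> N. norm (hybrid f \<rho> t0 p) / real p)
      \<le> ?F + (norm \<rho> * ln (ln (real N) / ln (real t0 + 1)) + 6)"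
    unfolding * by (simp add: hybrid_prime)
  then have "exp ((\<Sum>p | prime p \<and> p \<le> N. norm (hybrid f \<rho> t0 p) / real p) + 2)
      \<le> exp (8 + ?F + norm \<rho> * ln (ln (real N) / ln (real t0 + 1)))"
    by simp
  also have "\<dots> = exp 8 * exp ?F * (ln (real N) / ln (real t0 + 1)) powr norm \<rho>"
    using l by (simp add: exp_add powr_def)
  finally have "exp ((\<Sum>p | prime p \<and> p \<le> N. norm (hybrid f \<rho> t0 p) / real p) + 2)
      \<le> exp 8 * exp ?F * (ln (real N) / ln (real t0 + 1)) powr norm \<rho>" .
  with sum_multiplicative_le_exp show ?thesis
    by (rule order_trans) (intro multiplicative_hybrid norm_hybrid_le f \<rho>; assumption)+
qed

section \<open>Assembly of the bound, with \<open>e\<close> for \<open>E y\<close>\<close>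

lemma norm_mean_value_le:
  fixes f :: "nat \<Rightarrow> complex" and C x y z M e :: real
  assumes "C > 0" and mult: "multiplicative_fun f" and f: "\<And>n. n > 0 \<Longrightarrow> norm (f n) \<le> 1"
    and M: "M \<ge> 1" and y: "4 < y" and yz: "y \<le> z powr (1/2)" and z: "0 < z" "z < x"
    and e: "e > 0" and \<rho>: "norm \<rho> \<le> 1"
    and hyp: "\<And>Y. Y \<ge> y \<Longrightarrow> norm ((\<Sum>p | prime p \<and> y < real p \<and> real p \<le> Y. f p)
                    - \<rho> * of_real (real (primes_pi Y) - real (primes_pi y))) \<le> C * M * Y * e"
  shows "norm (\<Sum>n | 0 < n \<and> real n \<le> x. f n)
        \<le> (ln 4 * exp 8 + 5 + 20 * C) * (norm \<rho> * x / ln z * (ln x / ln y) powr (norm \<rho>)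
                   * exp (\<Sum>p | prime p \<and> real p \<le> y. norm (f p) / real p)
               + real (smooth_count x z)
               + M * x * (ln x)\<^sup>2 * (e + 1 / y))"
proof -
  define N where "N = nat \<lfloor>x\<rfloor>"
  define t0 where "t0 = nat \<lfloor>y\<rfloor>"
  let ?F = "\<Sum>p | prime p \<and> real p \<le> y. norm (f p) / real p"
  have "y\<^sup>2 \<le> (sqrt z)\<^sup>2" using yz y z by (intro power_mono) (auto simp: powr_half_sqrt)
  then have "y * y \<le> z" using z by (simp add: power2_eq_square)
  moreover have "4 * y \<le> y * y" using y by (intro mult_right_mono) auto
  ultimately have yz': "4 * y \<le> z" by linarith
  have le_N: "n \<le> N \<longleftrightarrow> real n \<le> x" for n using y yz' z by (simp add: N_def le_nat_iff le_floor_iff)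
  have le_t0: "n \<le> t0 \<longleftrightarrow> real n \<le> y" for n using y by (simp add: t0_def le_nat_iff le_floor_iff)
  have Nx: "real N \<le> x" using le_N[of N] by simp
  have t0y: "real t0 \<le> y" "y < real t0 + 1" using le_t0[of t0] le_t0[of "Suc t0"] by auto
  have t0: "t0 \<ge> 4" "t0 \<le> N" using y yz' z t0y le_t0[of 4] le_N[of t0] by auto
  \<comment> \<open>Here \<open>x > z \<ge> 4 * y > 16\<close>, well above
    \<open>exp 1\<close>.\<close>
  have lx: "ln x \<ge> 1"
    using exp_le y yz' z by (subst ln_ge_iff) auto
  have lz: "ln z > 0" and ly: "ln y > 0" using y yz' by auto
  have lN: "ln (real N) \<le> ln x" "ln (real N) > 0" using Nx t0 by auto
  have ln2: "1 + ln (real N) \<le> 2 * ln x" using lN lx by linarith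

  \<comment> \<open>The hypothesis in terms of the integer cutoff \<open>t0\<close>: for
    \<open>k > t0\<close> take \<open>Y = k\<close>, noting that \<open>y < t0 + 1 \<le> k\<close>;
    for smaller \<open>k\<close> the sum is empty.\<close>
  have "norm (\<Sum>p | prime p \<and> t0 < p \<and> p \<le> k. f p - \<rho>) \<le> C * M * e * real k" for k
  proof (cases "k \<le> t0")
    case True
    then have "{p. prime p \<and> t0 < p \<and> p \<le> k} = {}" by auto
    then show ?thesis using \<open>C > 0\<close> M e by (simp only: sum.empty) simp
  next
    case False
    then have "y \<le> real k" using t0y by linarith
    let ?Q = "{p. prime p \<and> y < real p \<and> real p \<le> real k}"
    have fin: "finite {p::nat. prime p \<and> real p \<le> u}" for u
      by (rule finite_subset [of _ "{..nat \<lfloor>u\<rfloor>}"]) (auto simp: le_nat_floor)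
    have fin_Q: "finite ?Q" by (rule finite_subset [OF _ fin [of "real k"]]) auto
    have "primes_pi (real k) = card ({p::nat. prime p \<and> real p \<le> y} \<union> ?Q)"
      unfolding primes_pi_def using \<open>y \<le> real k\<close> by (intro arg_cong [of _ _ card]) auto
    also have "\<dots> = primes_pi y + card ?Q"
      unfolding primes_pi_def by (intro card_Un_disjoint fin fin_Q) auto
    finally have "real (primes_pi (real k)) - real (primes_pi y) = real (card ?Q)" by simp
    moreover have "{p. prime p \<and> t0 < p \<and> p \<le> k} = ?Q" using le_t0 by (auto simp flip: not_le)
    ultimately show ?thesis using hyp[OF \<open>y \<le> real k\<close>]
      by (simp add: sum_subtractf mult_ac)
  qed
  then have "norm ((\<Sum>n\<in>{1..N}. f n) - (\<Sum>n\<in>{1..N}. hybrid f \<rho> t0 n))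
      \<le> 5 * (C * M * e) * real N * (1 + ln (real N))\<^sup>2 + 2 * real N / real t0"
    using t0 by (intro norm_sum_diff_hybrid_le mult f \<rho>) auto
  also have "\<dots> \<le> 5 * (C * M * e) * x * (2 * ln x)\<^sup>2 + 4 * (M * x * (ln x)\<^sup>2 * (1 / y))"
  proof (rule add_mono)
    show "5 * (C * M * e) * real N * (1 + ln (real N))\<^sup>2 \<le> 5 * (C * M * e) * x * (2 * ln x)\<^sup>2"
      using \<open>C > 0\<close> M e Nx lN(2) ln2 t0 by (intro mult_mono power_mono) auto
    \<comment> \<open>\<open>t0 > y - 1 > y / 2\<close>, since \<open>y > 4\<close>.\<close>
    have "2 * real N / real t0 \<le> 2 * x / (y / 2)"
      using Nx t0y y by (intro frac_le) auto
    also have "\<dots> = 4 * (1 * x * 1 * (1 / y))" by simp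
    also have "\<dots> \<le> 4 * (M * x * (ln x)\<^sup>2 * (1 / y))"
      using M lx y yz' z by (intro mult_left_mono mult_mono one_le_power) auto
    finally show "2 * real N / real t0 \<le> 4 * (M * x * (ln x)\<^sup>2 * (1 / y))" .
  qed
  finally have 1: "norm ((\<Sum>n\<in>{1..N}. f n) - (\<Sum>n\<in>{1..N}. hybrid f \<rho> t0 n))
      \<le> 20 * C * (M * x * (ln x)\<^sup>2 * e) + 4 * (M * x * (ln x)\<^sup>2 * (1 / y))"
    by (simp add: power_mult_distrib mult_ac)

  have "norm (\<Sum>n\<in>{1..N}. hybrid f \<rho> t0 n) \<le> (\<Sum>n\<in>{1..N}. norm (hybrid f \<rho> t0 n))"
    by (rule norm_sum)
  also have "\<dots> = (\<Sum>n | n \<in> {1..N} \<and> smooth_nat z n. norm (hybrid f \<rho> t0 n))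
      + (\<Sum>n | n \<in> {1..N} \<and> \<not> smooth_nat z n. norm (hybrid f \<rho> t0 n))"
    by (subst sum.union_disjoint [symmetric]) (auto intro!: sum.cong)
  also have "(\<Sum>n | n \<in> {1..N} \<and> smooth_nat z n. norm (hybrid f \<rho> t0 n))
      \<le> (\<Sum>n | n \<in> {1..N} \<and> smooth_nat z n. 1)"
    by (intro sum_mono norm_hybrid_le f \<rho>)
  also have "\<dots> = real (smooth_count x z)"
    unfolding smooth_count_def
    by simp (auto simp: smooth_nat_def le_N Suc_le_eq intro!: arg_cong [of _ _ card])
  also have "(\<Sum>n | n \<in> {1..N} \<and> \<not> smooth_nat z n. norm (hybrid f \<rho> t0 n))
      \<le> norm \<rho> * real N * (ln 4 / ln z) * (\<Sum>m\<in>{1..N}. norm (hybrid f \<rho> t0 m) / real m)"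
    using t0y y yz' by (intro sum_norm_hybrid_not_smooth_le) auto
  also have "\<dots> \<le> norm \<rho> * x * (ln 4 / ln z) * (exp 8 * exp ?F * (ln x / ln y) powr norm \<rho>)"
  proof (rule mult_mono)
    show "norm \<rho> * real N * (ln 4 / ln z) \<le> norm \<rho> * x * (ln 4 / ln z)"
      using Nx lz by (intro mult_right_mono mult_left_mono) auto
    have "(\<Sum>m\<in>{1..N}. norm (hybrid f \<rho> t0 m) / real m)
        \<le> exp 8 * exp ?F * (ln (real N) / ln (real t0 + 1)) powr norm \<rho>"
      using sum_norm_hybrid_div_le[of f \<rho> t0 N] f \<rho> t0 by (simp add: le_t0)
    \<comment> \<open>Having \<open>t0 + 1\<close> rather than \<open>t0\<close> in the denominator
      matters here: \<open>y < t0 + 1\<close>.\<close>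
    also have "\<dots> \<le> exp 8 * exp ?F * (ln x / ln y) powr norm \<rho>"
      using lN ly t0y y by (intro mult_left_mono powr_mono2 frac_le) auto
    finally show "(\<Sum>m\<in>{1..N}. norm (hybrid f \<rho> t0 m) / real m)
        \<le> exp 8 * exp ?F * (ln x / ln y) powr norm \<rho>" .
  qed (use lz y yz' z in \<open>auto intro!: sum_nonneg divide_nonneg_nonneg mult_nonneg_nonneg\<close>)
  also have "\<dots> = ln 4 * exp 8 * (norm \<rho> * x / ln z * (ln x / ln y) powr (norm \<rho>) * exp ?F)"
    by simp
  finally have 2: "norm (\<Sum>n\<in>{1..N}. hybrid f \<rho> t0 n) \<le> real (smooth_count x z)
      + ln 4 * exp 8 * (norm \<rho> * x / ln z * (ln x / ln y) powr (norm \<rho>) * exp ?F)"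
    by simp

  define T1 where "T1 = norm \<rho> * x / ln z * (ln x / ln y) powr (norm \<rho>) * exp ?F"
  define T2 where "T2 = real (smooth_count x z)"
  define T3 where "T3 = M * x * (ln x)\<^sup>2 * e"
  define T4 where "T4 = M * x * (ln x)\<^sup>2 * (1 / y)"
  \<comment> \<open>The estimates give \<open>T1\<close> to \<open>T4\<close> the coefficients
    \<open>ln 4 * exp 8\<close>, 1, \<open>20 * C\<close> and 4; \<open>K\<close> dominates each of
    them. The factor 20 is 5 times the 4 from \<open>(2 * ln x)\<^sup>2\<close>.\<close>
  define K where "K = ln 4 * exp 8 + 5 + 20 * C"
  have T: "T1 \<ge> 0" "T2 \<ge> 0" "T3 \<ge> 0" "T4 \<ge> 0"
    using lz y yz' z e M by (auto simp: T1_def T2_def T3_def T4_def)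
  have "ln 4 * exp 8 \<ge> (0::real)" by simp
  then have K: "ln 4 * exp 8 \<le> K" "1 \<le> K" "20 * C \<le> K" "4 \<le> K"
    using \<open>C > 0\<close> unfolding K_def by linarith+
  have "{n. 0 < n \<and> real n \<le> x} = {1..N}" by (auto simp: le_N)
  then have "norm (\<Sum>n | 0 < n \<and> real n \<le> x. f n) \<le> T2 + ln 4 * exp 8 * T1 + (20 * C * T3 + 4 * T4)"
    using 1 2 norm_triangle_sub[of "\<Sum>n\<in>{1..N}. f n" "\<Sum>n\<in>{1..N}. hybrid f \<rho> t0 n"]
    unfolding T1_def T2_def T3_def T4_def by simp
  also have "\<dots> \<le> K * T2 + K * T1 + (K * T3 + K * T4)"
    using K(2) mult_right_mono[OF K(2) T(2)] by (intro add_mono mult_right_mono K T) auto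
  also have "\<dots> = K * (T1 + T2 + M * x * (ln x)\<^sup>2 * (e + 1 / y))"
    by (simp add: T3_def T4_def algebra_simps)
  finally show ?thesis unfolding T1_def T2_def K_def .
qed

theorem theorem1p1:
  fixes C :: real
  assumes "C > 0"
  shows "\<exists>K::real. \<forall>(f :: nat \<Rightarrow> complex) (x::real) (y::real) (z::real) (M::real)
           (E :: real \<Rightarrow> real) (\<rho>::complex).
      multiplicative_fun f \<longrightarrow>
      (\<forall>n>0. norm (f n) \<le> 1) \<longrightarrow>
      M \<ge> 1 \<longrightarrow> 4 < y \<longrightarrow> y \<le> z powr (1/2) \<longrightarrow> 0 < z \<longrightarrow> z < x \<longrightarrow>
      (\<forall>X>0. E X > 0) \<longrightarrow> antimono_on {0<..} E \<longrightarrow> (E \<longlongrightarrow> 0) at_top \<longrightarrow>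
      norm \<rho> \<le> 1 \<longrightarrow>
      (\<forall>Y\<ge>y. norm ((\<Sum>p | prime p \<and> y < real p \<and> real p \<le> Y. f p)
                    - \<rho> * of_real (real (primes_pi Y) - real (primes_pi y)))
              \<le> C * M * Y * E y) \<longrightarrow>
      norm (\<Sum>n | 0 < n \<and> real n \<le> x. f n)
        \<le> K * (norm \<rho> * x / ln z * (ln x / ln y) powr (norm \<rho>)
                   * exp (\<Sum>p | prime p \<and> real p \<le> y. norm (f p) / real p)
               + real (smooth_count x z)
               + M * x * (ln x)\<^sup>2 * (E y + 1 / y))"
  using assms by (intro exI [of _ "ln 4 * exp 8 + 5 + 20 * C"] allI impI norm_mean_value_le) auto

end
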